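(* For any $n,r\in\mathbb{N}$, $$\frac{2^n\,n!}{(2n+1)!}\sum_{(\lambda^0,\lambda^1,\ldots,\lambda^{2n})\in\mathcal{OT}(\emptyset,2n)}\ \sum_{i=0}^{2n}\binom{|\lambda^i|}{r}=\frac{2^r\,r!^2}{(2r+1)!}\binom{n}{r}.$$
   Context: $\mathbb{N}=\{0,1,2,\ldots\}$. A partition is a finite weakly decreasing sequence of positive integers (the empty sequence $\emptyset$ is allowed); its size $|\lambda|$ is the sum of its parts, and it is identified with its Young diagram. An oscillating tableau of shape $\lambda$ and length $l$ is a sequence of partitions $T=(\lambda^0,\lambda^1,\ldots,\lambda^l)$ with $\lambda^0=\emptyset$, $\lambda^l=\lambda$, and, for each $0\le i\le l-1$, $\lambda^{i+1}$ obtained from $\lambda^i$ by adding one box to or removing one box from its Young diagram. $\mathcal{OT}(\lambda,l)$ denotes the set of oscillating tableaux of shape $\lambda$ and length $l$. *)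

theory Defs
  imports Complex_Main
begin

definition is_partition :: "nat list \<Rightarrow> bool" where
  "is_partition p \<longleftrightarrow> sorted_wrt (\<ge>) p \<and> (\<forall>k \<in> set p. 0 < k)"

definition partition_size :: "nat list \<Rightarrow> nat" where
  "partition_size p = sum_list p"

text \<open>Boxes are (row, column) pairs, both indexed from 0.\<close>

definition young_diagram :: "nat list \<Rightarrow> (nat \<times> nat) set" where
  "young_diagram p = {(i, j). i < length p \<and> j < p ! i}"

definition adds_box :: "nat list \<Rightarrow> nat list \<Rightarrow> bool" where
  "adds_box p q \<longleftrightarrow>
     (\<exists>b. b \<notin> young_diagram p \<and> young_diagram q = insert b (young_diagram p))"

text \<open>A tableau of length \<open>l\<close> has \<open>l\<close> steps, hence is a list of \<open>l + 1\<close> partitions;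
  \<open>T ! i\<close> is its \<open>i\<close>-th partition.\<close>

definition oscillating_tableaux :: "nat list \<Rightarrow> nat \<Rightarrow> nat list list set" where
  "oscillating_tableaux p l =
     {T. length T = Suc l \<and> (\<forall>i \<le> l. is_partition (T ! i)) \<and>
         T ! 0 = [] \<and> T ! l = p \<and>
         (\<forall>i < l. adds_box (T ! i) (T ! Suc i) \<or> adds_box (T ! Suc i) (T ! i))}"

lemma young_diagram_Sigma: "young_diagram p = (SIGMA i:{..<length p}. {..<p ! i})"
  by (auto simp: young_diagram_def)

lemma finite_young_diagram: "finite (young_diagram p)"
  by (simp add: young_diagram_Sigma)

lemma card_young_diagram: "card (young_diagram p) = partition_size p"
  by (simp add: young_diagram_Sigma partition_size_def sum_list_sum_nth atLeast0LessThan)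

lemma adds_box_size: "adds_box p q \<Longrightarrow> partition_size q = Suc (partition_size p)"
  unfolding adds_box_def card_young_diagram [symmetric] by (auto simp: finite_young_diagram)

lemma length_le_partition_size: "is_partition p \<Longrightarrow> length p \<le> partition_size p"
  by (induction p) (auto simp: is_partition_def partition_size_def)

text \<open>Sums over infinite sets are 0 by convention; this shows that sums over oscillating
  tableaux are genuine finite sums.\<close>

lemma finite_oscillating_tableaux: "finite (oscillating_tableaux p l)"
proof (rule finite_subset)
  let ?P = "{q. set q \<subseteq> {..l} \<and> length q \<le> l}"
  show "finite {T. set T \<subseteq> ?P \<and> length T = Suc l}"
    by (intro finite_lists_length_eq finite_lists_length_le) simp
  show "oscillating_tableaux p l \<subseteq> {T. set T \<subseteq> ?P \<and> length T = Suc l}"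
  proof
    fix T assume T: "T \<in> oscillating_tableaux p l"
    have size: "i \<le> l \<longrightarrow> partition_size (T ! i) \<le> i" for i
    proof (induction i)
      case 0
      then show ?case using T by (simp add: oscillating_tableaux_def partition_size_def)
    next
      case (Suc i)
      show ?case
      proof
        assume i: "Suc i \<le> l"
        then have "adds_box (T ! i) (T ! Suc i) \<or> adds_box (T ! Suc i) (T ! i)"
          using T by (simp add: oscillating_tableaux_def)
        then show "partition_size (T ! Suc i) \<le> Suc i"
        proof
          assume "adds_box (T ! i) (T ! Suc i)"
          from adds_box_size [OF this] show ?thesis using Suc i by simp
        next
          assume "adds_box (T ! Suc i) (T ! i)"
          from adds_box_size [OF this] show ?thesis using Suc i by simp
        qed
      qed
    qed
    have elem: "T ! i \<in> ?P" if i: "i \<le> l" for i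
    proof -
      have s: "partition_size (T ! i) \<le> l" using size i by (meson le_trans)
      have "is_partition (T ! i)" using T i by (simp add: oscillating_tableaux_def)
      then have "length (T ! i) \<le> l"
        using length_le_partition_size s le_trans by blast
      moreover have "k \<le> l" if "k \<in> set (T ! i)" for k
        using member_le_sum_list [OF that] s by (simp add: partition_size_def)
      ultimately show ?thesis by auto
    qed
    have len: "length T = Suc l" using T by (simp add: oscillating_tableaux_def)
    have "set T \<subseteq> ?P"
    proof
      fix q assume "q \<in> set T"
      then obtain i where "i < Suc l" "q = T ! i" by (metis in_set_conv_nth len)
      then show "q \<in> ?P" using elem [of i] by simp
    qed
    with len show "T \<in> {T. set T \<subseteq> ?P \<and> length T = Suc l}" by simp
  qed
qed

end

theory Submission
  imports Defs
begin

text \<open>Young's lattice is a differential poset: the up and down operators satisfy \<open>DU = UD + 1\<close>.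
  Hence the walks that start at the empty partition can be counted in the Fock space
  representation of this relation, where \<open>|\<lambda>|\<close> becomes the number operator and
  \<open>binomial |\<lambda>| r\<close> becomes \<open>U\<^sup>r D\<^sup>r / r!\<close>. As the commutators of \<open>D\<close> and \<open>U\<close> with
  \<open>X\<^sup>j\<close>, where \<open>X = U + D\<close>, are \<open>j X\<^sup>j\<^sup>-\<^sup>1\<close> up to sign, the sum of \<open>binomial |\<lambda>\<^sup>i| r\<close> over all tableaux is
  \<open>r! (binomial i r) (binomial (2n - i) r) (2n - 2r - 1)!!\<close>, and the sum over \<open>i\<close> is a
  Vandermonde convolution.\<close>

section \<open>The Fock space\<close>

text \<open>A function \<open>b\<close> holds the coefficients of a combination of the vectors U^m
  applied to the bottom element. In these coordinates \<open>raise\<close> and \<open>lower\<close>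
  are U and D, because D U^(m+1) and (m+1) U^m agree on the bottom element. On polynomials they are
  multiplication by x and d/dx.\<close>

definition raise :: "(nat \<Rightarrow> nat) \<Rightarrow> nat \<Rightarrow> nat" where
  "raise b m = (case m of 0 \<Rightarrow> 0 | Suc k \<Rightarrow> b k)"

definition lower :: "(nat \<Rightarrow> nat) \<Rightarrow> nat \<Rightarrow> nat" where
  "lower b m = Suc m * b (Suc m)"

definition hop :: "(nat \<Rightarrow> nat) \<Rightarrow> nat \<Rightarrow> nat" where
  "hop b m = raise b m + lower b m"

definition vacuum :: "nat \<Rightarrow> nat" where
  "vacuum m = of_bool (m = 0)"

definition choose_mult :: "nat \<Rightarrow> (nat \<Rightarrow> nat) \<Rightarrow> nat \<Rightarrow> nat" where
  "choose_mult r b m = (m choose r) * b m"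

section \<open>Linearity and commutation relations of the operators\<close>

lemma hop_add: "hop (\<lambda>m. b m + c m) = (\<lambda>m. hop b m + hop c m)"
  by (auto simp: hop_def raise_def lower_def algebra_simps split: nat.split)

lemma hop_scale: "hop (\<lambda>m. c * b m) = (\<lambda>m. c * hop b m)"
  by (auto simp: hop_def raise_def lower_def algebra_simps split: nat.split)

lemma hop_pow_scale: "(hop ^^ j) (\<lambda>m. c * b m) = (\<lambda>m. c * (hop ^^ j) b m)"
  by (induction j) (simp_all add: hop_scale)

text \<open>Since U commutes with itself, [X, U] = [D, U] = 1; likewise [D, X] = [D, U] = 1 in
  \<open>lower_hop\<close>. Both are written additively, as the coefficients are natural
  numbers.\<close>

lemma hop_raise: "hop (raise b) = (\<lambda>m. raise (hop b) m + b m)"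
  by (auto simp: hop_def raise_def lower_def algebra_simps split: nat.split)

lemma lower_hop: "lower (hop b) = (\<lambda>m. hop (lower b) m + b m)"
  by (auto simp: hop_def raise_def lower_def algebra_simps split: nat.split)

text \<open>Moving U past each of the \<open>Suc j\<close> factors X leaves one copy of X^j
  behind.\<close>

lemma hop_pow_raise:
  "(hop ^^ Suc j) (raise b) = (\<lambda>m. raise ((hop ^^ Suc j) b) m + Suc j * (hop ^^ j) b m)"
proof (induction j)
  case 0
  show ?case by (simp add: hop_raise)
next
  case (Suc j)
  have "(hop ^^ Suc (Suc j)) (raise b) = hop ((hop ^^ Suc j) (raise b))"
    by simp
  also have "\<dots> = (\<lambda>m. hop (raise ((hop ^^ Suc j) b)) m + Suc j * hop ((hop ^^ j) b) m)"
    unfolding Suc hop_add hop_scale ..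
  also have "\<dots> = (\<lambda>m. raise ((hop ^^ Suc (Suc j)) b) m + Suc (Suc j) * (hop ^^ Suc j) b m)"
    by (simp add: hop_raise algebra_simps)
  finally show ?case .
qed

lemma lower_hop_pow:
  "lower ((hop ^^ Suc j) b) = (\<lambda>m. (hop ^^ Suc j) (lower b) m + Suc j * (hop ^^ j) b m)"
proof (induction j)
  case 0
  show ?case by (simp add: lower_hop)
next
  case (Suc j)
  have "lower ((hop ^^ Suc (Suc j)) b) = (\<lambda>m. hop (lower ((hop ^^ Suc j) b)) m + (hop ^^ Suc j) b m)"
    by (simp add: lower_hop)
  also have "\<dots> = (\<lambda>m. hop ((hop ^^ Suc j) (lower b)) m + Suc j * hop ((hop ^^ j) b) m + (hop ^^ Suc j) b m)"
    unfolding Suc hop_add hop_scale ..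
  also have "\<dots> = (\<lambda>m. (hop ^^ Suc (Suc j)) (lower b) m + Suc (Suc j) * (hop ^^ Suc j) b m)"
    by (simp add: algebra_simps)
  finally show ?case .
qed

lemma lower_vacuum: "lower vacuum = (\<lambda>m. 0)"
  by (simp add: lower_def vacuum_def fun_eq_iff)

lemma lower_hop_pow_vacuum: "lower ((hop ^^ Suc i) vacuum) = (\<lambda>m. Suc i * (hop ^^ i) vacuum m)"
proof -
  have "(hop ^^ k) (\<lambda>m. 0) = (\<lambda>m. 0)" for k
    using hop_pow_scale[of k 0] by simp
  then show ?thesis
    by (simp only: lower_hop_pow lower_vacuum) simp
qed

text \<open>With N the number operator, this is (r+1) binom(N, r+1) = U binom(N, r) D, the
  absorption identity for binomials. It peels one U and one D off U^r D^r / r!.\<close>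

lemma choose_mult_Suc:
  "(\<lambda>m. Suc r * choose_mult (Suc r) b m) = raise (choose_mult r (lower b))"
proof
  fix m
  show "Suc r * choose_mult (Suc r) b m = raise (choose_mult r (lower b)) m"
  proof (cases m)
    case (Suc k)
    have "Suc r * (Suc k choose Suc r) = Suc k * (k choose r)"
      by (simp only: Suc_times_binomial_eq mult.commute)
    then have "Suc r * (Suc k choose Suc r) * b (Suc k) = Suc k * (k choose r) * b (Suc k)"
      by (rule arg_cong)
    then show ?thesis
      unfolding Suc by (simp only: choose_mult_def raise_def lower_def nat.case ac_simps)
  qed (simp add: choose_mult_def raise_def)
qed

text \<open>Induction on \<open>r\<close>: the peeled D moves right through X^i until it kills the
  vacuum, and the peeled U moves left through X^j until it meets the coefficient at 0, where
  \<open>raise\<close> vanishes. Only the commutators i X^(i-1) and j X^(j-1) survive. If the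
  subtraction truncates, one of the binomials is 0.\<close>

lemma vacuum_expectation:
  "(hop ^^ j) (choose_mult r ((hop ^^ i) vacuum)) 0
     = fact r * (i choose r) * (j choose r) * (hop ^^ (i + j - 2 * r)) vacuum 0"
proof (induction r arbitrary: i j)
  case 0
  have "choose_mult 0 b = b" for b
    by (simp add: choose_mult_def fun_eq_iff)
  moreover have "(hop ^^ j) ((hop ^^ i) vacuum) = (hop ^^ (i + j)) vacuum"
    by (simp add: funpow_add add.commute[of i])
  ultimately show ?case by simp
next
  case (Suc r)
  \<comment> \<open>The recursion determines \<open>Suc r * e\<close>; the factor is cancelled at
    the end to stay within the naturals.\<close>
  define e where "e = (hop ^^ j) (choose_mult (Suc r) ((hop ^^ i) vacuum)) 0"
  have e: "Suc r * e = (hop ^^ j) (raise (choose_mult r (lower ((hop ^^ i) vacuum)))) 0"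
    by (simp add: e_def hop_pow_scale choose_mult_Suc [symmetric] del: mult_Suc)
  show ?case
  proof (cases "i = 0 \<or> j = 0")
    \<comment> \<open>For \<open>i = 0\<close> the operator D meets the vacuum directly; for
      \<open>j = 0\<close> the value of \<open>raise\<close> at 0 is read off directly.\<close>
    case True
    have "(hop ^^ j) (\<lambda>m. 0) 0 = 0"
      using hop_pow_scale[of j 0] by simp
    moreover have "raise (choose_mult r (\<lambda>m. 0)) = (\<lambda>m. 0)"
      by (auto simp: raise_def choose_mult_def split: nat.split)
    ultimately have "e = 0"
      using True e by (auto simp: lower_vacuum) (simp add: raise_def)
    with True show ?thesis by (auto simp: e_def)
  next
    case False
    then obtain i' j' where ij: "i = Suc i'" "j = Suc j'"
      by (meson not0_implies_Suc)
    have d: "Suc i' + Suc j' - 2 * Suc r = i' + j' - 2 * r"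
      by simp
    have scale: "choose_mult r (\<lambda>m. Suc i' * b m) = (\<lambda>m. Suc i' * choose_mult r b m)" for b
      by (simp add: choose_mult_def fun_eq_iff algebra_simps)
    have "Suc r * e = Suc i' * (Suc j' * (hop ^^ j') (choose_mult r ((hop ^^ i') vacuum)) 0)"
      unfolding e ij lower_hop_pow_vacuum scale hop_pow_raise hop_pow_scale
      by (simp add: raise_def ac_simps del: mult_Suc)
    also have "\<dots> = fact r * (Suc i' * (i' choose r)) * (Suc j' * (j' choose r))
        * (hop ^^ (i' + j' - 2 * r)) vacuum 0"
      unfolding Suc by (simp only: ac_simps)
    also have "\<dots> = Suc r * (fact (Suc r) * (i choose Suc r) * (j choose Suc r)
        * (hop ^^ (i + j - 2 * Suc r)) vacuum 0)"
      unfolding ij d Suc_times_binomial_eq fact_Suc by (simp only: of_nat_id ac_simps)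
    finally show ?thesis
      unfolding e_def by (simp only: mult_cancel1 nat.simps simp_thms)
  qed
qed

text \<open>The value is the double factorial (2s-1)!!, stated without division.\<close>

lemma hop_pow_even_vacuum: "2 ^ s * fact s * (hop ^^ (2 * s)) vacuum 0 = fact (2 * s)"
proof (induction s)
  case 0
  show ?case by (simp add: vacuum_def)
next
  case (Suc s)
  \<comment> \<open>At coefficient 0 the outermost X acts as D alone, and commuting this D to the
    vacuum yields the factor 2s+1.\<close>
  have "(hop ^^ (2 * Suc s)) vacuum 0 = lower ((hop ^^ Suc (2 * s)) vacuum) 0"
    by (simp add: hop_def [of _ 0] raise_def)
  also have "\<dots> = Suc (2 * s) * (hop ^^ (2 * s)) vacuum 0"
    unfolding lower_hop_pow_vacuum ..
  finally have "2 ^ Suc s * fact (Suc s) * (hop ^^ (2 * Suc s)) vacuum 0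
      = (2 * Suc s) * Suc (2 * s) * (2 ^ s * fact s * (hop ^^ (2 * s)) vacuum 0)"
    by (simp only: power_Suc fact_Suc of_nat_id ac_simps)
  also have "\<dots> = fact (2 * Suc s)"
    unfolding Suc by (simp add: algebra_simps)
  finally show ?case .
qed

text \<open>Both sides count the (r+s+1)-subsets of {0..N}, the left one according to the (r+1)-st
  smallest element i. The proof applies Pascal's rule to the second factor.\<close>

lemma sum_choose_mult_choose:
  "(\<Sum>i\<le>N. (i choose r) * ((N - i) choose s)) = Suc N choose (r + s + 1)"
proof (induction N arbitrary: s)
  case 0
  show ?case by (cases r; cases s) auto
next
  case (Suc N)
  show ?case
  proof (cases s)
    case 0
    then show ?thesis using sum_choose_upper[of r "Suc N"] by (simp add: atMost_atLeast0)
  next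
    case s: (Suc t)
    \<comment> \<open>The term at \<open>i = Suc N\<close> vanishes because \<open>s\<close> is
      positive here.\<close>
    have "(\<Sum>i\<le>Suc N. (i choose r) * ((Suc N - i) choose s))
        = (\<Sum>i\<le>N. (i choose r) * ((N - i) choose t) + (i choose r) * ((N - i) choose s))"
      by (simp add: s Suc_diff_le algebra_simps)
    then show ?thesis
      by (simp add: sum.distrib Suc.IH s)
  qed
qed

section \<open>Walks in differential posets\<close>

text \<open>\<open>card_up\<close> and \<open>card_common\<close> are the diagonal and the
  off-diagonal matrix entries of DU = UD + 1.\<close>

locale differential_poset =
  fixes S :: "'a set" and cov :: "'a \<Rightarrow> 'a \<Rightarrow> bool" and rank :: "'a \<Rightarrow> nat" and bottom :: 'a
  assumes bottom_in: "bottom \<in> S"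
    and rank_bottom: "rank bottom = 0"
    and rank_cov: "cov x y \<Longrightarrow> rank y = Suc (rank x)"
    and finite_up: "x \<in> S \<Longrightarrow> finite {y \<in> S. cov x y}"
    and finite_down: "x \<in> S \<Longrightarrow> finite {y \<in> S. cov y x}"
    and card_up: "x \<in> S \<Longrightarrow> card {y \<in> S. cov x y} = Suc (card {y \<in> S. cov y x})"
    and card_common: "x \<in> S \<Longrightarrow> y \<in> S \<Longrightarrow> x \<noteq> y \<Longrightarrow>
      card {z \<in> S. cov x z \<and> cov y z} = card {z \<in> S. cov z x \<and> cov z y}"
begin

definition up :: "'a \<Rightarrow> 'a set" where "up x = {y \<in> S. cov x y}"

definition down :: "'a \<Rightarrow> 'a set" where "down x = {y \<in> S. cov y x}"

lemma finite_up_down: "x \<in> S \<Longrightarrow> finite (up x)" "x \<in> S \<Longrightarrow> finite (down x)"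
  by (simp_all add: up_def down_def finite_up finite_down)

lemma up_down_in: "y \<in> up x \<Longrightarrow> y \<in> S" "y \<in> down x \<Longrightarrow> y \<in> S"
  by (simp_all add: up_def down_def)

lemma rank_up: "y \<in> up x \<Longrightarrow> rank y = Suc (rank x)"
  by (simp add: up_def rank_cov)

lemma rank_down: "y \<in> down x \<Longrightarrow> rank x = Suc (rank y)"
  by (simp add: down_def rank_cov)

lemma down_bottom: "down bottom = {}"
  using rank_down rank_bottom by fastforce

text \<open>The relation DU = UD + 1 tested on \<open>g\<close>. The weight of \<open>g z\<close> is
  the number of common upper covers of x and z on the left, and of common lower covers on the right;
  the extra \<open>g x\<close> is the surplus at z = x.\<close>

lemma down_up_commute:
  fixes g :: "'a \<Rightarrow> nat"
  assumes x: "x \<in> S"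
  shows "(\<Sum>y\<in>up x. \<Sum>z\<in>down y. g z) = (\<Sum>y\<in>down x. \<Sum>z\<in>up y. g z) + g x"
proof -
  \<comment> \<open>One finite index set for both double sums, so that they can be swapped and
    compared term by term; \<open>x\<close> is included to carry the term
    \<open>g x\<close>.\<close>
  define Z where "Z = insert x ((\<Union>y\<in>up x. down y) \<union> (\<Union>y\<in>down x. up y))"
  have finZ: "finite Z" and ZS: "Z \<subseteq> S"
    using x by (auto simp: Z_def finite_up_down up_down_in)
  have sum_Z: "(\<Sum>z\<in>Z. if z \<in> A then g z else 0) = (\<Sum>z\<in>A. g z)" if "A \<subseteq> Z" for A
    using that by (simp add: sum.inter_restrict[OF finZ, symmetric] Int_absorb1)
  have sum_if: "(\<Sum>y\<in>B. if y \<in> C then c else 0) = card (B \<inter> C) * c" if "finite B" for B C :: "'a set" and c :: nat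
    by (simp add: sum.inter_restrict[OF that, symmetric])
  have "(\<Sum>y\<in>up x. \<Sum>z\<in>down y. g z) = (\<Sum>y\<in>up x. \<Sum>z\<in>Z. if z \<in> down y then g z else 0)"
    by (rule sum.cong[OF refl], rule sum_Z[symmetric]) (auto simp: Z_def)
  also have "\<dots> = (\<Sum>z\<in>Z. \<Sum>y\<in>up x. if z \<in> down y then g z else 0)"
    by (rule sum.swap)
  also have "\<dots> = (\<Sum>z\<in>Z. \<Sum>y\<in>up x. if y \<in> up z then g z else 0)"
    using ZS by (intro sum.cong refl) (auto simp: up_def down_def)
  also have "\<dots> = (\<Sum>z\<in>Z. card (up x \<inter> up z) * g z)"
    by (simp only: sum_if finite_up_down x)
  also have "\<dots> = (\<Sum>z\<in>Z. card (down x \<inter> down z) * g z + (if z = x then g z else 0))"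
  proof (intro sum.cong refl)
    fix z assume "z \<in> Z"
    then have z: "z \<in> S" using ZS by blast
    have "up x \<inter> up z = {y \<in> S. cov x y \<and> cov z y}" "down x \<inter> down z = {y \<in> S. cov y x \<and> cov y z}"
      by (auto simp: up_def down_def)
    then show "card (up x \<inter> up z) * g z = card (down x \<inter> down z) * g z + (if z = x then g z else 0)"
      using card_common[OF x z] card_up[OF x] by (cases "z = x") auto
  qed
  also have "\<dots> = (\<Sum>z\<in>Z. card (down x \<inter> down z) * g z) + g x"
    using finZ by (simp add: sum.distrib) (simp add: Z_def)
  also have "(\<Sum>z\<in>Z. card (down x \<inter> down z) * g z)
      = (\<Sum>z\<in>Z. \<Sum>y\<in>down x. if z \<in> up y then g z else 0)"
    unfolding sum_if[OF finite_up_down(2)[OF x], symmetric]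
    using ZS by (intro sum.cong refl) (auto simp: up_def down_def)
  also have "\<dots> = (\<Sum>y\<in>down x. \<Sum>z\<in>Z. if z \<in> up y then g z else 0)"
    by (rule sum.swap)
  also have "\<dots> = (\<Sum>y\<in>down x. \<Sum>z\<in>up y. g z)"
    by (rule sum.cong[OF refl], rule sum_Z) (auto simp: Z_def)
  finally show ?thesis .
qed

text \<open>\<open>chains k x\<close> is the coefficient of x in U^k applied to the bottom element:
  the number of saturated chains of k steps from bottom to x. It is zero unless k is the rank of
  x.\<close>

primrec chains :: "nat \<Rightarrow> 'a \<Rightarrow> nat" where
  "chains 0 x = of_bool (x = bottom)"
| "chains (Suc k) x = (\<Sum>y\<in>down x. chains k y)"

text \<open>This is D U^(k+1) = (k+1) U^k on the bottom element, read off at x. Each exchange of D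
  with a U adds one, and D kills the bottom element.\<close>

lemma sum_up_chains: "x \<in> S \<Longrightarrow> (\<Sum>y\<in>up x. chains (Suc k) y) = Suc k * chains k x"
proof (induction k arbitrary: x)
  case 0
  have "chains 0 z = 0" if "y \<in> down x" "z \<in> up y" for y z
    using that by (auto dest: rank_up simp: rank_bottom)
  with down_up_commute[OF 0, of "chains 0"] show ?case
    by simp
next
  case (Suc k)
  have "(\<Sum>y\<in>up x. chains (Suc (Suc k)) y)
      = (\<Sum>y\<in>down x. \<Sum>z\<in>up y. chains (Suc k) z) + chains (Suc k) x"
    unfolding chains.simps(2)[of "Suc k"] by (rule down_up_commute[OF Suc.prems])
  also have "(\<Sum>y\<in>down x. \<Sum>z\<in>up y. chains (Suc k) z) = (\<Sum>y\<in>down x. Suc k * chains k y)"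
    by (intro sum.cong refl Suc.IH up_down_in)
  finally show ?case
    by (simp add: sum_distrib_left sum.distrib)
qed

section \<open>Walks and their weighted sums\<close>

definition walks :: "nat \<Rightarrow> 'a \<Rightarrow> 'a list set" where
  "walks l x = {T. length T = Suc l \<and> (\<forall>i \<le> l. T ! i \<in> S) \<and> T ! 0 = bottom \<and> T ! l = x \<and>
     (\<forall>i < l. cov (T ! i) (T ! Suc i) \<or> cov (T ! Suc i) (T ! i))}"

lemma walks_0: "walks 0 x = (if x = bottom then {[bottom]} else {})"
  by (auto simp: walks_def length_Suc_conv bottom_in)

lemma walks_Suc:
  assumes x: "x \<in> S"
  shows "walks (Suc l) x = (\<Union>y\<in>down x \<union> up x. (\<lambda>T. T @ [x]) ` walks l y)"
proof (intro set_eqI iffI)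
  fix T assume T: "T \<in> walks (Suc l) x"
  then have len: "length T = Suc (Suc l)" and last: "T ! Suc l = x"
    by (simp_all add: walks_def)
  define T' where "T' = butlast T"
  have len': "length T' = Suc l" by (simp add: T'_def len)
  have nth: "T' ! i = T ! i" if "i \<le> l" for i
    using that len by (simp add: T'_def nth_butlast)
  have "T = T' @ [last T]" using len by (simp add: T'_def) (metis append_butlast_last_id length_0_conv nat.distinct(1))
  moreover have "last T = x" using len last by (metis diff_Suc_1 last_conv_nth length_0_conv nat.distinct(1))
  ultimately have Tx: "T = T' @ [x]" by simp
  have "T' \<in> walks l (T ! l)"
    using T len' by (simp add: walks_def nth)
  moreover have "T ! l \<in> down x \<union> up x"
    using T by (auto simp: walks_def up_def down_def)
  ultimately show "T \<in> (\<Union>y\<in>down x \<union> up x. (\<lambda>T. T @ [x]) ` walks l y)"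
    using Tx by blast
next
  fix T assume "T \<in> (\<Union>y\<in>down x \<union> up x. (\<lambda>T. T @ [x]) ` walks l y)"
  then obtain y T' where y: "y \<in> down x \<union> up x" and T': "T' \<in> walks l y" and T: "T = T' @ [x]"
    by blast
  have adj: "cov x y \<or> cov y x" using y by (auto simp: up_def down_def)
  show "T \<in> walks (Suc l) x"
    using T' adj x unfolding T walks_def
    by (auto simp: nth_append le_Suc_eq less_Suc_eq)
qed

lemma finite_walks: "x \<in> S \<Longrightarrow> finite (walks l x)"
  by (induction l arbitrary: x) (auto simp: walks_0 walks_Suc finite_up_down up_down_in)

lemma walks_length: "T \<in> walks l x \<Longrightarrow> length T = Suc l"
  by (simp add: walks_def)

lemma walks_last: "T \<in> walks l x \<Longrightarrow> T ! l = x"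
  by (simp add: walks_def)

text \<open>The common induction step for counting walks and for weighting them by a rank at a fixed
  time: an additional step keeps the vector of sums in the span of the U^m applied to bottom and
  acts there as X. By \<open>ext\<close>, the weight ignores the new endpoint.\<close>

lemma sum_walks_Suc:
  fixes F :: "'a list \<Rightarrow> nat"
  assumes F: "\<And>x. x \<in> S \<Longrightarrow> (\<Sum>T\<in>walks l x. F T) = b (rank x) * chains (rank x) x"
    and ext: "\<And>T x. length T = Suc l \<Longrightarrow> F (T @ [x]) = F T"
    and x: "x \<in> S"
  shows "(\<Sum>T\<in>walks (Suc l) x. F T) = hop b (rank x) * chains (rank x) x"
proof -
  have disj: "down x \<inter> up x = {}"
    using rank_up rank_down by fastforce
  have "(\<Sum>T\<in>walks (Suc l) x. F T) = (\<Sum>y\<in>down x \<union> up x. \<Sum>T\<in>(\<lambda>T. T @ [x]) ` walks l y. F T)"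
    unfolding walks_Suc[OF x]
    by (rule sum.UNION_disjoint) (use x in \<open>auto simp: finite_up_down finite_walks up_down_in dest: walks_last\<close>)
  also have "\<dots> = (\<Sum>y\<in>down x \<union> up x. \<Sum>T\<in>walks l y. F T)"
    by (rule sum.cong[OF refl]) (simp add: sum.reindex inj_on_def ext walks_length)
  also have "\<dots> = (\<Sum>y\<in>down x \<union> up x. b (rank y) * chains (rank y) y)"
    by (intro sum.cong refl F) (auto simp: up_down_in)
  also have "\<dots> = (\<Sum>y\<in>down x. b (rank y) * chains (rank y) y) + (\<Sum>y\<in>up x. b (rank y) * chains (rank y) y)"
    by (intro sum.union_disjoint finite_up_down x disj)
  \<comment> \<open>A walk arriving from above ends with a down step, whence \<open>lower\<close>;
    \<open>sum_up_chains\<close> supplies its factor \<open>Suc (rank x)\<close>.\<close>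
  also have "(\<Sum>y\<in>up x. b (rank y) * chains (rank y) y) = lower b (rank x) * chains (rank x) x"
    using sum_up_chains[OF x, of "rank x"]
    by (simp add: rank_up sum_distrib_left [symmetric] lower_def ac_simps del: chains.simps mult_Suc)
  \<comment> \<open>A walk arriving from below ends with an up step; here the recursion of
    \<open>chains\<close> suffices.\<close>
  also have "(\<Sum>y\<in>down x. b (rank y) * chains (rank y) y) = raise b (rank x) * chains (rank x) x"
  proof (cases "rank x")
    case 0
    then have "down x = {}" using rank_down by fastforce
    with 0 show ?thesis by (simp add: raise_def)
  next
    case (Suc k)
    then have "rank y = k" if "y \<in> down x" for y using rank_down[OF that] by simp
    then show ?thesis by (simp add: Suc raise_def sum_distrib_left)
  qed
  finally show ?thesis by (simp add: hop_def algebra_simps)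
qed

lemma card_walks: "x \<in> S \<Longrightarrow> card (walks i x) = (hop ^^ i) vacuum (rank x) * chains (rank x) x"
proof (induction i arbitrary: x)
  case 0
  show ?case by (cases "rank x") (auto simp: walks_0 vacuum_def rank_bottom)
next
  case (Suc i)
  then show ?case
    using sum_walks_Suc[where F = "\<lambda>_. 1" and l = i and b = "(hop ^^ i) vacuum"] by simp
qed

text \<open>After i steps the weight acts as the diagonal operator \<open>choose_mult r\<close>,
  since all walks ending at x share it; the remaining j steps apply X^j.\<close>

lemma sum_walks_choose_rank:
  "x \<in> S \<Longrightarrow> (\<Sum>T\<in>walks (i + j) x. rank (T ! i) choose r)
    = (hop ^^ j) (choose_mult r ((hop ^^ i) vacuum)) (rank x) * chains (rank x) x"
proof (induction j arbitrary: x)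
  case 0
  have "(\<Sum>T\<in>walks i x. rank (T ! i) choose r) = (\<Sum>T\<in>walks i x. rank x choose r)"
    by (intro sum.cong refl) (simp add: walks_last)
  then show ?case
    by (simp add: card_walks[OF 0] choose_mult_def)
next
  case (Suc j)
  then show ?case
    using sum_walks_Suc[where F = "\<lambda>T. rank (T ! i) choose r" and l = "i + j"
        and b = "(hop ^^ j) (choose_mult r ((hop ^^ i) vacuum))"]
    by (simp add: nth_append)
qed

theorem sum_closed_walks_choose_rank:
  "(\<Sum>T\<in>walks l bottom. \<Sum>i\<le>l. rank (T ! i) choose r)
    = fact r * (Suc l choose (2 * r + 1)) * (hop ^^ (l - 2 * r)) vacuum 0"
proof -
  have "(\<Sum>T\<in>walks l bottom. \<Sum>i\<le>l. rank (T ! i) choose r)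
      = (\<Sum>i\<le>l. \<Sum>T\<in>walks l bottom. rank (T ! i) choose r)"
    by (rule sum.swap)
  also have "\<dots> = (\<Sum>i\<le>l. fact r * (i choose r) * ((l - i) choose r) * (hop ^^ (l - 2 * r)) vacuum 0)"
  proof (intro sum.cong refl)
    fix i assume "i \<in> {..l}"
    then have i: "i + (l - i) = l" by simp
    show "(\<Sum>T\<in>walks l bottom. rank (T ! i) choose r)
        = fact r * (i choose r) * ((l - i) choose r) * (hop ^^ (l - 2 * r)) vacuum 0"
      using sum_walks_choose_rank[OF bottom_in, where i = i and j = "l - i" and r = r]
      by (simp add: i rank_bottom vacuum_expectation)
  qed
  also have "\<dots> = fact r * (\<Sum>i\<le>l. (i choose r) * ((l - i) choose r)) * (hop ^^ (l - 2 * r)) vacuum 0"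
    by (simp add: sum_distrib_left sum_distrib_right ac_simps)
  finally show ?thesis
    by (simp only: sum_choose_mult_choose mult_2)
qed

end

section \<open>Young's lattice\<close>

text \<open>Padding with zeros makes starting a new row the same operation as extending an old one.
  Partitions become the weakly decreasing functions that reach 0.\<close>

definition rows :: "nat list \<Rightarrow> nat \<Rightarrow> nat" where
  "rows p i = (if i < length p then p ! i else 0)"

lemma young_diagram_rows: "young_diagram p = {(i, j). j < rows p i}"
  by (auto simp: young_diagram_def rows_def split: if_splits)

lemma antimono_rows: "is_partition p \<Longrightarrow> antimono (rows p)"
  by (auto simp: decseq_Suc_iff rows_def is_partition_def sorted_wrt_iff_nth_less)

lemma rows_pos_iff: "is_partition p \<Longrightarrow> 0 < rows p i \<longleftrightarrow> i < length p"
  by (auto simp: rows_def is_partition_def)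

lemma rows_inj:
  assumes "is_partition p" "is_partition q" "rows p = rows q"
  shows "p = q"
proof -
  have "i < length p \<longleftrightarrow> i < length q" for i
    using assms rows_pos_iff by metis
  then have "length p = length q" by (meson linorder_neqE_nat less_irrefl)
  then show ?thesis
    using assms(3) by (intro nth_equalityI) (auto simp: rows_def fun_eq_iff dest: spec split: if_splits)
qed

lemma rows_surj:
  assumes f: "antimono f" "f n = 0"
  shows "\<exists>p. is_partition p \<and> rows p = f"
proof -
  \<comment> \<open>Cutting at the first zero keeps all parts positive, and monotonicity makes
    everything beyond it zero.\<close>
  define N where "N = (LEAST n. f n = 0)"
  have N: "f N = 0" unfolding N_def using f(2) by (rule LeastI)
  have pos: "0 < f i" if "i < N" for i
    using that not_less_Least unfolding N_def by blast
  have zero: "f i = 0" if "N \<le> i" for i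
    using antimonoD[OF f(1) that] N by simp
  have "is_partition (map f [0..<N])"
    using pos antimonoD[OF f(1)] by (auto simp: is_partition_def sorted_wrt_iff_nth_less)
  moreover have "rows (map f [0..<N]) = f"
    using zero by (auto simp: rows_def fun_eq_iff)
  ultimately show ?thesis by blast
qed

definition partition_of_rows :: "(nat \<Rightarrow> nat) \<Rightarrow> nat list" where
  "partition_of_rows f = (SOME p. is_partition p \<and> rows p = f)"

lemma partition_of_rows:
  assumes "antimono f" "f n = 0"
  shows "is_partition (partition_of_rows f)" "rows (partition_of_rows f) = f"
  using someI_ex[OF rows_surj[OF assms]] by (simp_all add: partition_of_rows_def)

lemma rows_eventually_0: "rows p (length p) = 0"
  by (simp add: rows_def)

lemma adds_box_rows: "adds_box p q \<longleftrightarrow> (\<exists>i. rows q = (rows p)(i := Suc (rows p i)))"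
proof
  assume "adds_box p q"
  then obtain i j where b: "(i, j) \<notin> young_diagram p" "young_diagram q = insert (i, j) (young_diagram p)"
    by (auto simp: adds_box_def)
  have b': "(k, m) \<in> young_diagram q \<longleftrightarrow> (k, m) = (i, j) \<or> (k, m) \<in> young_diagram p" for k m
    unfolding b(2) by blast
  have mem: "m < rows q k \<longleftrightarrow> (k = i \<and> m = j) \<or> m < rows p k" for k m
    using b' by (simp add: young_diagram_rows)
  have "rows q k = rows p k" if "k \<noteq> i" for k
    using mem[of _ k] that by (meson linorder_neqE_nat less_irrefl)
  moreover have "rows q i = Suc (rows p i)"
  proof -
    \<comment> \<open>Rows are initial segments, so comparing cardinalities shows that row i grows
      by one without locating the column j.\<close>
    have "{..<rows q i} = insert j {..<rows p i}" using mem[of _ i] by auto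
    then have "card {..<rows q i} = card (insert j {..<rows p i})" by (rule arg_cong)
    then show ?thesis using b(1) by (simp add: young_diagram_rows)
  qed
  ultimately show "\<exists>i. rows q = (rows p)(i := Suc (rows p i))"
    by (intro exI[of _ i]) (simp add: fun_eq_iff)
next
  assume "\<exists>i. rows q = (rows p)(i := Suc (rows p i))"
  then obtain i where "rows q = (rows p)(i := Suc (rows p i))" ..
  then show "adds_box p q"
    unfolding adds_box_def young_diagram_rows
    \<comment> \<open>The new box occupies the first free column of row i.\<close>
    by (intro exI[of _ "(i, rows p i)"]) (auto split: if_splits)
qed

section \<open>Common covers as joins and meets\<close>

lemma add_row_eqD:
  fixes f g h :: "nat \<Rightarrow> nat"
  assumes "g = f(i := Suc (f i))" "g = h(j := Suc (h j))" "f \<noteq> h"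
  shows "g = sup f h" "f = (inf f h)(j := Suc (inf f h j))" "h = (inf f h)(i := Suc (inf f h i))"
proof -
  have eq: "(f(i := Suc (f i))) k = (h(j := Suc (h j))) k" for k
    using assms by simp
  \<comment> \<open>Raising the same row of f and h to a common result would force f = h.\<close>
  have ij: "i \<noteq> j"
  proof
    assume "i = j"
    with eq have "f k = h k" for k by (auto split: if_splits simp: fun_upd_def) (metis nat.inject)
    with assms(3) show False by blast
  qed
  have ends: "h i = Suc (f i)" "f j = Suc (h j)"
    using eq[of i] eq[of j] ij by simp_all
  have "g k = sup f h k \<and> f k = ((inf f h)(j := Suc (inf f h j))) k
      \<and> h k = ((inf f h)(i := Suc (inf f h i))) k" for k
  proof (cases "k = i \<or> k = j")
    case True
    then show ?thesis
      unfolding assms(1) using ends ij by (auto simp: sup_nat_def inf_nat_def)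
  next
    case False
    then show ?thesis
      using eq[of k] by (simp add: assms(1))
  qed
  then show "g = sup f h" "f = (inf f h)(j := Suc (inf f h j))" "h = (inf f h)(i := Suc (inf f h i))"
    by blast+
qed

lemma remove_row_eqD:
  fixes f g h :: "nat \<Rightarrow> nat"
  assumes "f = g(i := Suc (g i))" "h = g(j := Suc (g j))" "f \<noteq> h"
  shows "g = inf f h" "sup f h = f(j := Suc (f j))" "sup f h = h(i := Suc (h i))"
proof -
  have "i \<noteq> j" using assms by auto
  then show "g = inf f h" "sup f h = f(j := Suc (f j))" "sup f h = h(i := Suc (h i))"
    unfolding assms(1,2) by (auto simp: fun_eq_iff sup_nat_def inf_nat_def)
qed

lemma antimono_sup_inf:
  fixes f h :: "nat \<Rightarrow> nat"
  assumes "antimono f" "antimono h"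
  shows "antimono (sup f h)" "antimono (inf f h)"
  using assms unfolding decseq_Suc_iff by (auto simp: sup_nat_def inf_nat_def 
    intro: max.coboundedI1 max.coboundedI2 min.coboundedI1 min.coboundedI2)

text \<open>A common upper cover must be the join, and its existence makes the meet a common lower
  cover; the converse is dual. So the two sets are both empty or both singletons.\<close>

lemma card_common_covers:
  assumes p: "is_partition p" and q: "is_partition q" and "p \<noteq> q"
  shows "card {z. is_partition z \<and> adds_box p z \<and> adds_box q z}
       = card {z. is_partition z \<and> adds_box z p \<and> adds_box z q}" (is "card ?A = card ?B")
proof -
  let ?f = "rows p" and ?h = "rows q"
  have ne: "?f \<noteq> ?h" using rows_inj assms by blast
  have anti: "antimono (sup ?f ?h)" "antimono (inf ?f ?h)"
    by (simp_all add: antimono_sup_inf antimono_rows p q)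
  have "rows p (length p + length q) = 0" "rows q (length p + length q) = 0"
    by (simp_all add: rows_def)
  then have 0: "sup ?f ?h (length p + length q) = 0" "inf ?f ?h (length p + length q) = 0"
    by simp_all
  define s where "s = partition_of_rows (sup ?f ?h)"
  define m where "m = partition_of_rows (inf ?f ?h)"
  have s: "is_partition s" "rows s = sup ?f ?h" and m: "is_partition m" "rows m = inf ?f ?h"
    unfolding s_def m_def using partition_of_rows anti 0 by blast+
  have A: "z = s \<and> m \<in> ?B" if "z \<in> ?A" for z
  proof -
    from that obtain i j where "rows z = ?f(i := Suc (?f i))" "rows z = ?h(j := Suc (?h j))"
      by (auto simp: adds_box_rows)
    note D = add_row_eqD[OF this ne]
    have "z = s" using that D(1) s rows_inj by simp
    moreover have "adds_box m p" "adds_box m q"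
      unfolding adds_box_rows m using D(2,3) by blast+
    ultimately show ?thesis using m by simp
  qed
  have B: "z = m \<and> s \<in> ?A" if "z \<in> ?B" for z
  proof -
    from that obtain i j where "?f = (rows z)(i := Suc (rows z i))" "?h = (rows z)(j := Suc (rows z j))"
      by (auto simp: adds_box_rows)
    note D = remove_row_eqD[OF this ne]
    have "z = m" using that D(1) m rows_inj by simp
    moreover have "adds_box p s" "adds_box q s"
      unfolding adds_box_rows s using D(2,3) by blast+
    ultimately show ?thesis using s by simp
  qed
  have "?A = {} \<and> ?B = {} \<or> ?A = {s} \<and> ?B = {m}"
    using A B by blast
  then show ?thesis
    by (elim disjE conjE) (simp_all only: card.empty is_singletonI[THEN is_singleton_altdef[THEN iffD1]])
qed

text \<open>A box fits in row 0, or in row k+1 exactly when row k is strictly longer. Such rows k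
  are also those from which a box can be removed, so this indexing exhibits one more upper cover
  than lower covers.\<close>

lemma covers_above_bij:
  assumes p: "is_partition p"
  shows "bij_betw (\<lambda>i. partition_of_rows ((rows p)(i := Suc (rows p i))))
    (insert 0 (Suc ` {i. rows p (Suc i) < rows p i})) {q. is_partition q \<and> adds_box p q}"
    (is "bij_betw ?g ?I ?A")
proof -
  let ?f = "rows p"
  have f: "antimono ?f" using p by (rule antimono_rows)
  have anti: "antimono (?f(i := Suc (?f i))) \<longleftrightarrow> i \<in> ?I" for i
  proof (cases i)
    case 0
    have "antimono (?f(0 := Suc (?f 0)))"
      using f unfolding decseq_Suc_iff by (simp add: le_SucI)
    with 0 show ?thesis by simp
  next
    case (Suc k)
    have "antimono (?f(Suc k := Suc (?f (Suc k)))) \<longleftrightarrow> Suc (?f (Suc k)) \<le> ?f k"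
      using f unfolding decseq_Suc_iff by (auto simp: le_SucI split: if_splits dest: spec[of _ k])
    with Suc show ?thesis by auto
  qed
  have g: "is_partition (?g i)" "rows (?g i) = ?f(i := Suc (?f i))" if "i \<in> ?I" for i
  proof -
    \<comment> \<open>An index beyond both the changed row and the end of \<open>p\<close> provides
      the zero required by \<open>partition_of_rows\<close>.\<close>
    have "(?f(i := Suc (?f i))) (Suc (i + length p)) = 0" by (simp add: rows_def)
    then show "is_partition (?g i)" "rows (?g i) = ?f(i := Suc (?f i))"
      using that anti[of i] partition_of_rows by blast+
  qed
  show ?thesis
  proof (rule bij_betw_imageI)
    show "inj_on ?g ?I"
    proof (rule inj_onI)
      fix i j assume "i \<in> ?I" "j \<in> ?I" "?g i = ?g j"
      then have "?f(i := Suc (?f i)) = ?f(j := Suc (?f j))" using g by metis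
      then have "(?f(i := Suc (?f i))) i = (?f(j := Suc (?f j))) i" by (rule arg_cong)
      then show "i = j" by (auto split: if_splits)
    qed
    show "?g ` ?I = ?A"
    proof (intro set_eqI iffI)
      fix q assume "q \<in> ?g ` ?I"
      then show "q \<in> ?A" using g by (auto simp only: adds_box_rows mem_Collect_eq)
    next
      fix q assume q: "q \<in> ?A"
      then obtain i where i: "rows q = ?f(i := Suc (?f i))" by (auto simp: adds_box_rows)
      then have iI: "i \<in> ?I" using q anti[of i] antimono_rows[of q] by simp
      then have "q = ?g i" using rows_inj g i q by (metis (mono_tags, lifting) mem_Collect_eq)
      with iI show "q \<in> ?g ` ?I" by blast
    qed
  qed
qed

lemma covers_below_bij:
  assumes p: "is_partition p"
  shows "bij_betw (\<lambda>i. partition_of_rows ((rows p)(i := rows p i - 1)))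
    {i. rows p (Suc i) < rows p i} {q. is_partition q \<and> adds_box q p}"
    (is "bij_betw ?g ?I ?A")
proof -
  let ?f = "rows p"
  have f: "antimono ?f" using p by (rule antimono_rows)
  have anti: "antimono (?f(i := ?f i - 1))" if "i \<in> ?I" for i
    using f that unfolding decseq_Suc_iff by (auto simp: le_diff_conv le_SucI)
  have g: "is_partition (?g i)" "rows (?g i) = ?f(i := ?f i - 1)" if "i \<in> ?I" for i
  proof -
    have "(?f(i := ?f i - 1)) (Suc (i + length p)) = 0" by (simp add: rows_def)
    then show "is_partition (?g i)" "rows (?g i) = ?f(i := ?f i - 1)"
      using anti[OF that] partition_of_rows by blast+
  qed
  show ?thesis
  proof (rule bij_betw_imageI)
    show "inj_on ?g ?I"
    proof (rule inj_onI)
      fix i j assume ij: "i \<in> ?I" "j \<in> ?I" "?g i = ?g j"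
      then have "?f(i := ?f i - 1) = ?f(j := ?f j - 1)" using g by metis
      then have "(?f(i := ?f i - 1)) i = (?f(j := ?f j - 1)) i" by (rule arg_cong)
      with ij(1) show "i = j" by (auto split: if_splits)
    qed
    show "?g ` ?I = ?A"
    proof (intro set_eqI iffI)
      fix q assume "q \<in> ?g ` ?I"
      then obtain i where i: "i \<in> ?I" "q = ?g i" by blast
      then have "?f = (rows q)(i := Suc (rows q i))" using g(2)[OF i(1)] by auto
      then show "q \<in> ?A" using g(1)[OF i(1)] i(2) by (auto simp only: adds_box_rows mem_Collect_eq)
    next
      fix q assume q: "q \<in> ?A"
      then obtain i where i: "?f = (rows q)(i := Suc (rows q i))" by (auto simp: adds_box_rows)
      \<comment> \<open>Row i of \<open>p\<close> is one longer than that of \<open>q\<close>, so it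
        strictly exceeds the next row.\<close>
      have "rows q (Suc i) \<le> rows q i"
        using q antimono_rows[of q] by (simp add: decseq_Suc_iff)
      then have iI: "i \<in> ?I" by (simp add: i)
      have "rows q = ?f(i := ?f i - 1)" by (simp add: i)
      then have "q = ?g i" using rows_inj g[OF iI] q by (metis (mono_tags, lifting) mem_Collect_eq)
      with iI show "q \<in> ?g ` ?I" by blast
    qed
  qed
qed

lemma finite_removable_rows: "finite {i. rows p (Suc i) < rows p i}"
  by (rule finite_subset[of _ "{..<length p}"]) (auto simp: rows_def split: if_splits)

section \<open>Young's lattice as a differential poset, and the tableau sum\<close>

interpretation young: differential_poset "{p. is_partition p}" adds_box partition_size "[]"
proof
  fix p q assume "p \<in> {p. is_partition p}" "q \<in> {p. is_partition p}" "p \<noteq> q"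
  then show "card {z \<in> {p. is_partition p}. adds_box p z \<and> adds_box q z}
      = card {z \<in> {p. is_partition p}. adds_box z p \<and> adds_box z q}"
    using card_common_covers by simp
next
  fix p assume "p \<in> {p. is_partition p}"
  then have p: "is_partition p" by simp
  note above = covers_above_bij[OF p] and below = covers_below_bij[OF p]
  show "finite {q \<in> {p. is_partition p}. adds_box p q}"
    using bij_betw_finite[OF above] finite_removable_rows by simp
  show "finite {q \<in> {p. is_partition p}. adds_box q p}"
    using bij_betw_finite[OF below] finite_removable_rows by simp
  show "card {q \<in> {p. is_partition p}. adds_box p q} = Suc (card {q \<in> {p. is_partition p}. adds_box q p})"
    using bij_betw_same_card[OF above] bij_betw_same_card[OF below] finite_removable_rows
    by (simp add: card_image)
qed (auto simp: is_partition_def partition_size_def adds_box_size[unfolded partition_size_def])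

theorem corollary1p4:
  fixes n r :: nat
  shows "(2 ^ n * fact n / fact (2 * n + 1) :: real) *
           (\<Sum>T \<in> oscillating_tableaux [] (2 * n).
              \<Sum>i = 0..2 * n. real (partition_size (T ! i) choose r))
         = 2 ^ r * (fact r)\<^sup>2 / fact (2 * r + 1) * real (n choose r)"
proof -
  have "oscillating_tableaux [] (2 * n) = young.walks (2 * n) []"
    by (simp add: oscillating_tableaux_def young.walks_def)
  then have sum: "(\<Sum>T \<in> oscillating_tableaux [] (2 * n).
      \<Sum>i = 0..2 * n. real (partition_size (T ! i) choose r))
    = fact r * real (Suc (2 * n) choose (2 * r + 1)) * real ((hop ^^ (2 * n - 2 * r)) vacuum 0)"
    using arg_cong[OF young.sum_closed_walks_choose_rank[where l = "2 * n" and r = r], of real]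
    by (simp add: atMost_atLeast0)
  show ?thesis
  proof (cases "r \<le> n")
    \<comment> \<open>Here r > n, so the binomials on both sides vanish.\<close>
    case False
    then show ?thesis unfolding sum by (simp add: binomial_eq_0)
  next
    case True
    then obtain s where n: "n = r + s" by (auto simp: le_iff_add)
    have "real (2 ^ s * fact s * (hop ^^ (2 * s)) vacuum 0) = real (fact (2 * s))"
      by (simp only: hop_pow_even_vacuum)
    then have h: "real ((hop ^^ (2 * s)) vacuum 0) = fact (2 * s) / (2 ^ s * fact s)"
      by (simp add: field_simps)
    have c1: "real (Suc (2 * n) choose (2 * r + 1)) = fact (2 * n + 1) / (fact (2 * r + 1) * fact (2 * s))"
      using binomial_fact[of "2 * r + 1" "Suc (2 * n)", where 'a = real] by (simp add: n)
    have c2: "real (n choose r) = fact n / (fact r * fact s)"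
      using binomial_fact[of r n, where 'a = real] by (simp add: n)
    have d: "2 * n - 2 * r = 2 * s" by (simp add: n)
    \<comment> \<open>After substitution (2n+1)! and (2s)! cancel, and n!/s! = r! binom(n, r) gives
      the right-hand side.\<close>
    have "(2::real) ^ n = 2 ^ r * 2 ^ s" by (simp add: n power_add)
    then show ?thesis
      unfolding sum d h c1 c2 by (simp add: divide_simps power2_eq_square del: fact_Suc)
  qed
qed

end
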